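(* Let $K\subset\mathbb{R}^n$ be a nonempty closed convex set and let $P:\mathbb{R}^n\to\mathbb{R}^n$ be a polynomial map of degree $d$, where $d$ is a positive integer. Assume that $K$ is a cone. If there exists $Q\in\mathcal{P}_{d-1}$ such that the following two conditions are satisfied: (a) $\mathrm{SOL}(K,P+Q)$ is nonempty and bounded; (b) the solution map $\mathrm{SOL}:\mathcal{P}_d\rightrightarrows\mathbb{R}^n$, $R\mapsto\mathrm{SOL}(K,R)$, is upper semicontinuous at $P+Q$; then $(K,P)$ is an $R_0$-pair.
   Context: For a nonempty closed convex set $K\subset\mathbb{R}^n$ and a continuous map $F:\mathbb{R}^n\to\mathbb{R}^n$, $\mathrm{SOL}(K,F)$ denotes the set of $x\in K$ such that $\langle F(x),y-x\rangle\ge 0$ for all $y\in K$. A nonempty set $C$ is a cone if $\lambda>0$ and $x\in C$ imply $\lambda x\in C$. The asymptotic cone of $K$ is $K^\infty=\{v\in\mathbb{R}^n:\exists t_k\to\infty,\ \exists x_k\in K,\ x_k/t_k\to v\}$ (the recession cone of $K$; it equals $K$ when $K$ is a closed convex cone). For a polynomial map $P=(P_1,\dots,P_n)$, its degree is $d=\max_l\deg P_l$, and $P^\infty=(P_1^\infty,\dots,P_n^\infty)$, where $P_l^\infty$ is the homogeneous component of degree $d$ of $P_l$. The pair $(K,P)$ is an $R_0$-pair if $\mathrm{SOL}(K^\infty,P^\infty)=\{0\}$. For an integer $e\ge0$, $\mathcal{P}_e$ is the finite-dimensional vector space of polynomial maps $\mathbb{R}^n\to\mathbb{R}^n$ all of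 whose components have degree at most $e$, normed by the Frobenius norm of the matrix of coefficients. A set-valued map $\Psi:X\rightrightarrows Y$ between topological spaces is upper semicontinuous at $x\in X$ if for every open $V\subset Y$ with $\Psi(x)\subset V$ there is a neighborhood $U$ of $x$ such that $\Psi(x')\subset V$ for all $x'\in U$. *)

theory Defs
  imports "HOL-Analysis.Analysis" "HOL-Library.Poly_Mapping"
begin

section \<open>Polynomial maps\<close>

text \<open>
  A real polynomial in the indeterminates \<open>x $ i\<close>, \<open>i :: 'n\<close>, is a finitely supported family of
  coefficients indexed by exponent vectors; a polynomial map is a vector of such polynomials.
  Since \<open>\<real>\<close> is infinite, this is the same as speaking of polynomial functions.
  Sums and differences of polynomial maps are those of \<^typ>\<open>('a, 'n) vec\<close> and of finitely
  supported functions.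
\<close>

type_synonym 'n polynomial = "('n \<Rightarrow>\<^sub>0 nat) \<Rightarrow>\<^sub>0 real"
type_synonym 'n polymap = "('n polynomial, 'n) vec"

definition mon_degree :: "('n::finite \<Rightarrow>\<^sub>0 nat) \<Rightarrow> nat" where
  "mon_degree \<alpha> = (\<Sum>i\<in>UNIV. Poly_Mapping.lookup \<alpha> i)"

definition poly_eval :: "('n::finite) polynomial \<Rightarrow> real ^ 'n \<Rightarrow> real" where
  "poly_eval p x = (\<Sum>\<alpha>\<in>Poly_Mapping.keys p. Poly_Mapping.lookup p \<alpha> * (\<Prod>i\<in>UNIV. (x $ i) ^ Poly_Mapping.lookup \<alpha> i))"

text \<open>The zero polynomial is given degree \<open>0\<close>.\<close>

definition poly_degree :: "('n::finite) polynomial \<Rightarrow> nat" where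
  "poly_degree p = Max (insert 0 (mon_degree ` Poly_Mapping.keys p))"

definition hom_component :: "nat \<Rightarrow> ('n::finite) polynomial \<Rightarrow> 'n polynomial" where
  "hom_component e p =
     (\<Sum>\<alpha>\<in>{\<alpha> \<in> Poly_Mapping.keys p. mon_degree \<alpha> = e}. Poly_Mapping.single \<alpha> (Poly_Mapping.lookup p \<alpha>))"

definition pm_eval :: "('n::finite) polymap \<Rightarrow> real ^ 'n \<Rightarrow> real ^ 'n" where
  "pm_eval P x = (\<chi> l. poly_eval (P $ l) x)"

definition pm_degree :: "('n::finite) polymap \<Rightarrow> nat" where
  "pm_degree P = Max (range (\<lambda>l. poly_degree (P $ l)))"

text \<open>All components are truncated at the degree of the whole map, so some may vanish.\<close>

definition pm_infinity :: "('n::finite) polymap \<Rightarrow> 'n polymap" where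
  "pm_infinity P = (\<chi> l. hom_component (pm_degree P) (P $ l))"

definition pm_space :: "nat \<Rightarrow> ('n::finite) polymap set" where
  "pm_space e = {P. \<forall>l. poly_degree (P $ l) \<le> e}"

text \<open>
  The Frobenius norm of the coefficient matrix; coefficients outside the support are \<open>0\<close> and do
  not contribute.
\<close>

definition pm_norm :: "('n::finite) polymap \<Rightarrow> real" where
  "pm_norm P = sqrt (\<Sum>l\<in>UNIV. \<Sum>\<alpha>\<in>Poly_Mapping.keys (P $ l). (Poly_Mapping.lookup (P $ l) \<alpha>)\<^sup>2)"

definition pm_dist :: "('n::finite) polymap \<Rightarrow> 'n polymap \<Rightarrow> real" where
  "pm_dist P Q = pm_norm (P - Q)"

lemma pm_norm_eq_L2_set:
  assumes "finite A" and "\<And>l. Poly_Mapping.keys (P $ l) \<subseteq> A"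
  shows "pm_norm P = L2_set (\<lambda>(l, \<alpha>). Poly_Mapping.lookup (P $ l) \<alpha>) (UNIV \<times> A)"
proof -
  have "(\<Sum>\<alpha>\<in>Poly_Mapping.keys (P $ l). (Poly_Mapping.lookup (P $ l) \<alpha>)\<^sup>2) = (\<Sum>\<alpha>\<in>A. (Poly_Mapping.lookup (P $ l) \<alpha>)\<^sup>2)" for l
    using assms by (intro sum.mono_neutral_left) (auto simp: in_keys_iff)
  then show ?thesis
    by (simp add: pm_norm_def L2_set_def sum.cartesian_product case_prod_unfold)
qed

lemma Metric_space_pm_dist: "Metric_space M pm_dist"
proof
  fix P Q R :: "'a polymap"
  define A where "A = (\<Union>l. Poly_Mapping.keys (P $ l) \<union> Poly_Mapping.keys (Q $ l) \<union> Poly_Mapping.keys (R $ l))"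
  have A: "finite A" by (simp add: A_def)
  have L2: "pm_dist S T = L2_set (\<lambda>(l, \<alpha>). Poly_Mapping.lookup (S $ l) \<alpha> - Poly_Mapping.lookup (T $ l) \<alpha>) (UNIV \<times> A)"
    if "S \<in> {P, Q, R}" "T \<in> {P, Q, R}" for S T
  proof -
    have "Poly_Mapping.keys ((S - T) $ l) \<subseteq> A" for l
    proof -
      have "Poly_Mapping.keys ((S - T) $ l) \<subseteq> Poly_Mapping.keys (S $ l) \<union> Poly_Mapping.keys (T $ l)"
        using keys_diff[of "S $ l" "T $ l"] by simp
      also have "\<dots> \<subseteq> A"
        using that by (auto simp only: A_def)
      finally show ?thesis .
    qed
    from pm_norm_eq_L2_set[OF A this] show ?thesis
      by (simp add: pm_dist_def lookup_minus)
  qed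
  show "0 \<le> pm_dist P Q"
    by (simp add: L2 L2_set_nonneg)
  show "pm_dist P Q = pm_dist Q P"
    by (simp add: L2 L2_set_def case_prod_unfold power2_commute)
  show "pm_dist P Q = 0 \<longleftrightarrow> P = Q"
  proof
    assume "pm_dist P Q = 0"
    then have "\<forall>l. \<forall>\<alpha>\<in>A. Poly_Mapping.lookup (P $ l) \<alpha> = Poly_Mapping.lookup (Q $ l) \<alpha>"
      using A by (simp add: L2 L2_set_eq_0_iff)
    moreover have "\<forall>l. \<forall>\<alpha>. \<alpha> \<notin> A \<longrightarrow> Poly_Mapping.lookup (P $ l) \<alpha> = Poly_Mapping.lookup (Q $ l) \<alpha>"
      by (auto simp: A_def in_keys_iff)
    ultimately show "P = Q"
      by (metis vec_eq_iff poly_mapping_eqI)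
  qed (simp add: pm_dist_def pm_norm_def)
  have "pm_dist P R = L2_set (\<lambda>z. (case z of (l, \<alpha>) \<Rightarrow> Poly_Mapping.lookup (P $ l) \<alpha> - Poly_Mapping.lookup (Q $ l) \<alpha>)
      + (case z of (l, \<alpha>) \<Rightarrow> Poly_Mapping.lookup (Q $ l) \<alpha> - Poly_Mapping.lookup (R $ l) \<alpha>)) (UNIV \<times> A)"
    by (simp add: L2 case_prod_unfold)
  also have "\<dots> \<le> pm_dist P Q + pm_dist Q R"
    unfolding L2[of P Q, simplified] L2[of Q R, simplified] by (rule L2_set_triangle_ineq)
  finally show "pm_dist P R \<le> pm_dist P Q + pm_dist Q R" .
qed

definition pm_topology :: "nat \<Rightarrow> ('n::finite) polymap topology" where
  "pm_topology e = Metric_space.mtopology (pm_space e) pm_dist"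

lemma topspace_pm_topology: "topspace (pm_topology e) = pm_space e"
  unfolding pm_topology_def by (rule Metric_space.topspace_mtopology[OF Metric_space_pm_dist])


section \<open>Variational inequalities\<close>

definition SOL :: "(real ^ 'n) set \<Rightarrow> (real ^ 'n \<Rightarrow> real ^ 'n) \<Rightarrow> (real ^ 'n::finite) set" where
  "SOL K F = {x \<in> K. \<forall>y\<in>K. F x \<bullet> (y - x) \<ge> 0}"

text \<open>
  In contrast to \<^const>\<open>cone\<close> and \<^const>\<open>conic\<close> from the library, a cone is nonempty here, and only
  closure under strictly positive multiples is demanded.
\<close>

definition is_cone :: "'a::real_vector set \<Rightarrow> bool" where
  "is_cone C \<longleftrightarrow> C \<noteq> {} \<and> (\<forall>c>0. \<forall>x\<in>C. c *\<^sub>R x \<in> C)"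

definition asymptotic_cone :: "'a::real_normed_vector set \<Rightarrow> 'a set" where
  "asymptotic_cone K =
     {v. \<exists>(t :: nat \<Rightarrow> real) (x :: nat \<Rightarrow> 'a). filterlim t at_top sequentially \<and> (\<forall>k. x k \<in> K) \<and>
           (\<lambda>k. x k /\<^sub>R t k) \<longlonglongrightarrow> v}"

definition R0_pair :: "(real ^ 'n) set \<Rightarrow> ('n::finite) polymap \<Rightarrow> bool" where
  "R0_pair K P \<longleftrightarrow> SOL (asymptotic_cone K) (pm_eval (pm_infinity P)) = {0}"

definition usc_at :: "'a topology \<Rightarrow> 'b topology \<Rightarrow> ('a \<Rightarrow> 'b set) \<Rightarrow> 'a \<Rightarrow> bool" where
  "usc_at X Y \<Psi> x \<longleftrightarrow> x \<in> topspace X \<and>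
     (\<forall>V. openin Y V \<and> \<Psi> x \<subseteq> V \<longrightarrow>
        (\<exists>U. openin X U \<and> x \<in> U \<and> (\<forall>x'\<in>U. \<Psi> x' \<subseteq> V)))"

end

theory Submission
  imports Defs
begin

text \<open>
  A closed cone \<open>K\<close> is its own asymptotic cone and contains \<open>0\<close>, where the form \<open>P\<^sup>\<infinity>\<close> of positive
  degree vanishes; so \<open>0\<close> is a solution for \<open>P\<^sup>\<infinity>\<close>, and the point is that there is no other.

  Suppose that \<open>x \<noteq> 0\<close> solves the problem of \<open>K\<close> and the leading part \<open>P\<^sup>\<infinity>\<close>. The ray through
  \<open>x\<close> is then, up to lower order terms, a ray of solutions for \<open>P + Q\<close>, and an arbitrarily small
  perturbation inside the maps of degree at most \<open>d\<close> makes any given far point of it an exact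
  solution. Indeed \<open>(P + Q) (t x) / t\<^sup>d\<close> tends to \<open>P\<^sup>\<infinity> x\<close> as \<open>t \<rightarrow> \<infinity>\<close>, because \<open>Q\<close> has smaller degree
  (\<open>tendsto_poly_eval_ray\<close>); call the defect \<open>c t = P\<^sup>\<infinity> x - (P + Q) (t x) / t\<^sup>d\<close>. Choose a coordinate
  \<open>i\<close> with \<open>x $ i \<noteq> 0\<close> and add to each component \<open>l\<close> of \<open>P + Q\<close> the monomial of degree \<open>d\<close> in the
  \<open>i\<close>-th variable with coefficient \<open>c t $ l / (x $ i) ^ d\<close>. The resulting map takes at \<open>t x\<close> the
  value \<open>t\<^sup>d P\<^sup>\<infinity> x\<close> exactly, and since \<open>K\<close> is a cone, \<open>t x\<close> solves its variational inequality
  (\<open>SOL_cone_scale\<close>). The added coefficients tend to \<open>0\<close>, so the perturbed maps converge to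
  \<open>P + Q\<close>, while their solutions \<open>t x\<close> are unbounded; upper semicontinuity at \<open>P + Q\<close>, applied
  to a ball around the bounded set \<open>SOL K (P + Q)\<close>, excludes this.
\<close>

section \<open>Evaluation and degree of polynomials\<close>

lemma poly_eval_superset:
  assumes "finite A" "Poly_Mapping.keys p \<subseteq> A"
  shows "poly_eval p x =
    (\<Sum>\<alpha>\<in>A. Poly_Mapping.lookup p \<alpha> * (\<Prod>i\<in>UNIV. (x $ i) ^ Poly_Mapping.lookup \<alpha> i))"
  unfolding poly_eval_def using assms
  by (intro sum.mono_neutral_left) (auto simp: in_keys_iff)

lemma poly_eval_add: "poly_eval (p + q) x = poly_eval p x + poly_eval q x"
proof -
  let ?A = "Poly_Mapping.keys p \<union> Poly_Mapping.keys q"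
  have "Poly_Mapping.keys (p + q) \<subseteq> ?A" by (rule Poly_Mapping.keys_add)
  then show ?thesis
    by (simp add: poly_eval_superset[where A = ?A] lookup_add distrib_right sum.distrib)
qed

lemma poly_eval_single:
  "poly_eval (Poly_Mapping.single \<alpha> c) x = c * (\<Prod>i\<in>UNIV. (x $ i) ^ Poly_Mapping.lookup \<alpha> i)"
  by (subst poly_eval_superset[where A = "{\<alpha>}"]) auto

lemma poly_degree_le_iff:
  "poly_degree p \<le> e \<longleftrightarrow> (\<forall>\<alpha>\<in>Poly_Mapping.keys p. mon_degree \<alpha> \<le> e)"
  unfolding poly_degree_def by (subst Max_le_iff) auto

lemma pm_space_add:
  assumes "P \<in> pm_space e" "Q \<in> pm_space e"
  shows "P + Q \<in> pm_space e"
  using assms Poly_Mapping.keys_add by (fastforce simp: pm_space_def poly_degree_le_iff)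

lemma monomial_scale:
  "(\<Prod>i\<in>UNIV. ((t *\<^sub>R x) $ i) ^ Poly_Mapping.lookup \<alpha> i) =
    t ^ mon_degree \<alpha> * (\<Prod>i\<in>UNIV. (x $ i) ^ Poly_Mapping.lookup \<alpha> i)"
  for x :: "real ^ 'n::finite"
  by (simp add: power_mult_distrib prod.distrib mon_degree_def power_sum)


section \<open>Leading homogeneous parts\<close>

lemma lookup_hom_component:
  "Poly_Mapping.lookup (hom_component e p) \<alpha> =
    (if mon_degree \<alpha> = e then Poly_Mapping.lookup p \<alpha> else 0)"
proof -
  have "Poly_Mapping.lookup (hom_component e p) \<alpha> =
      (\<Sum>\<beta>\<in>{\<beta> \<in> Poly_Mapping.keys p. mon_degree \<beta> = e}. if \<beta> = \<alpha> then Poly_Mapping.lookup p \<beta> else 0)"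
    by (simp add: hom_component_def lookup_sum lookup_single when_def)
  also have "\<dots> = (if mon_degree \<alpha> = e then Poly_Mapping.lookup p \<alpha> else 0)"
    by (auto simp: sum.delta in_keys_iff)
  finally show ?thesis .
qed

lemma hom_component_add_lower_degree:
  assumes "poly_degree q < e"
  shows "hom_component e (p + q) = hom_component e p"
proof (rule poly_mapping_eqI)
  fix \<alpha>
  have "Poly_Mapping.lookup q \<alpha> = 0" if "mon_degree \<alpha> = e"
    using assms that poly_degree_le_iff[of q "poly_degree q"] by (force simp: in_keys_iff)
  then show "Poly_Mapping.lookup (hom_component e (p + q)) \<alpha> = Poly_Mapping.lookup (hom_component e p) \<alpha>"
    by (simp add: lookup_hom_component lookup_add)
qed

lemma poly_eval_hom_component:
  "poly_eval (hom_component e p) x =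
    (\<Sum>\<alpha>\<in>Poly_Mapping.keys p. if mon_degree \<alpha> = e
       then Poly_Mapping.lookup p \<alpha> * (\<Prod>i\<in>UNIV. (x $ i) ^ Poly_Mapping.lookup \<alpha> i) else 0)"
proof -
  have "Poly_Mapping.keys (hom_component e p) \<subseteq> Poly_Mapping.keys p"
    by (auto simp: in_keys_iff lookup_hom_component split: if_splits)
  then show ?thesis
    by (subst poly_eval_superset[where A = "Poly_Mapping.keys p"])
       (auto simp: lookup_hom_component intro!: sum.cong)
qed

lemma poly_eval_hom_component_zero:
  assumes "e > 0"
  shows "poly_eval (hom_component e p) 0 = 0"
proof -
  have "(\<Prod>i\<in>UNIV. ((0 :: real ^ 'a) $ i) ^ Poly_Mapping.lookup \<alpha> i) = 0"
    if "mon_degree \<alpha> = e" for \<alpha> :: "'a \<Rightarrow>\<^sub>0 nat"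
    using monomial_scale[of 0 0 \<alpha>] assms that
    by (simp only: scaleR_zero_left zero_power mult_zero_left)
  then show ?thesis
    unfolding poly_eval_hom_component by (intro sum.neutral) simp
qed

text \<open>
  Along a ray a monomial of degree \<open>m\<close> grows like \<open>t ^ m\<close>, so after division by \<open>t ^ e\<close> only the
  monomials of degree exactly \<open>e\<close> survive in the limit.
\<close>

lemma tendsto_poly_eval_ray:
  assumes "poly_degree p \<le> e"
  shows "((\<lambda>t. poly_eval p (t *\<^sub>R x) / t ^ e) \<longlongrightarrow> poly_eval (hom_component e p) x) at_top"
proof -
  let ?M = "\<lambda>\<alpha>. Poly_Mapping.lookup p \<alpha> * (\<Prod>i\<in>UNIV. (x $ i) ^ Poly_Mapping.lookup \<alpha> i)"
  have lim: "((\<lambda>t::real. t ^ mon_degree \<alpha> / t ^ e) \<longlongrightarrow> (if mon_degree \<alpha> = e then 1 else 0)) at_top"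
    if "\<alpha> \<in> Poly_Mapping.keys p" for \<alpha>
  proof (cases "mon_degree \<alpha> = e")
    case True
    have "eventually (\<lambda>t::real. t ^ mon_degree \<alpha> / t ^ e = 1) at_top"
      using eventually_gt_at_top[of "0::real"] by eventually_elim (simp add: True)
    then show ?thesis
      unfolding if_P[OF True] by (rule tendsto_eventually)
  next
    case False
    with assms that have less: "mon_degree \<alpha> < e"
      by (force simp: poly_degree_le_iff)
    have "((\<lambda>t::real. inverse (t ^ (e - mon_degree \<alpha>))) \<longlongrightarrow> 0) at_top"
      using less by (intro tendsto_inverse_0_at_top filterlim_pow_at_top filterlim_ident) simp
    moreover have "eventually (\<lambda>t::real. inverse (t ^ (e - mon_degree \<alpha>)) = t ^ mon_degree \<alpha> / t ^ e) at_top"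
      using eventually_gt_at_top[of "0::real"]
      by eventually_elim (use less in \<open>simp add: power_diff field_simps\<close>)
    ultimately show ?thesis
      using False by (simp add: tendsto_cong)
  qed
  have "((\<lambda>t. \<Sum>\<alpha>\<in>Poly_Mapping.keys p. ?M \<alpha> * (t ^ mon_degree \<alpha> / t ^ e)) \<longlongrightarrow>
      (\<Sum>\<alpha>\<in>Poly_Mapping.keys p. ?M \<alpha> * (if mon_degree \<alpha> = e then 1 else 0))) at_top"
    by (intro tendsto_sum tendsto_mult tendsto_const lim)
  moreover have "(\<Sum>\<alpha>\<in>Poly_Mapping.keys p. ?M \<alpha> * (if mon_degree \<alpha> = e then 1 else 0)) =
      poly_eval (hom_component e p) x"
    unfolding poly_eval_hom_component by (intro sum.cong) auto
  moreover have "poly_eval p (t *\<^sub>R x) / t ^ e =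
      (\<Sum>\<alpha>\<in>Poly_Mapping.keys p. ?M \<alpha> * (t ^ mon_degree \<alpha> / t ^ e))" for t
    unfolding poly_eval_def monomial_scale sum_divide_distrib by (intro sum.cong) auto
  ultimately show ?thesis
    by simp
qed


section \<open>Perturbation by pure powers of one coordinate\<close>

text \<open>
  The value \<open>x $ i ^ d\<close> depends on a single coordinate, so as soon as \<open>x $ i \<noteq> 0\<close> these maps attain
  every prescribed vector at \<open>x\<close>, with coefficients proportional to it.
\<close>

definition power_perturbation :: "'n \<Rightarrow> nat \<Rightarrow> real ^ 'n \<Rightarrow> ('n::finite) polymap" where
  "power_perturbation i d a = (\<chi> l. Poly_Mapping.single (Poly_Mapping.single i d) (a $ l))"

lemma pm_eval_power_perturbation: "pm_eval (power_perturbation i d a) x = (x $ i) ^ d *\<^sub>R a"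
proof -
  have "(\<Prod>j\<in>UNIV. (x $ j) ^ Poly_Mapping.lookup (Poly_Mapping.single i d) j) =
      (\<Prod>j\<in>UNIV. if j = i then (x $ j) ^ d else 1)"
    by (intro prod.cong) (auto simp: lookup_single when_def)
  then show ?thesis
    by (simp add: vec_eq_iff pm_eval_def power_perturbation_def poly_eval_single)
qed

lemma power_perturbation_in_pm_space: "power_perturbation i d a \<in> pm_space d"
proof -
  have "mon_degree (Poly_Mapping.single i d) = d"
    by (simp add: mon_degree_def lookup_single when_def)
  then show ?thesis
    by (auto simp: pm_space_def power_perturbation_def poly_degree_le_iff)
qed

lemma pm_norm_power_perturbation: "pm_norm (power_perturbation i d a) = norm a"
proof -
  have "pm_norm (power_perturbation i d a) =
      L2_set (\<lambda>(l, \<alpha>). Poly_Mapping.lookup (power_perturbation i d a $ l) \<alpha>) (UNIV \<times> {Poly_Mapping.single i d})"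
    by (rule pm_norm_eq_L2_set) (auto simp: power_perturbation_def)
  also have "\<dots> = norm a"
    by (simp add: L2_set_def norm_vec_def sum.cartesian_product' power_perturbation_def)
  finally show ?thesis .
qed

lemma pm_eval_add: "pm_eval (P + Q) x = pm_eval P x + pm_eval Q x"
  by (simp add: vec_eq_iff pm_eval_def poly_eval_add)


section \<open>Closed cones\<close>

lemma zero_in_closed_cone:
  fixes K :: "'a::real_normed_vector set"
  assumes "closed K" "is_cone K"
  shows "0 \<in> K"
proof -
  obtain x where x: "x \<in> K" using assms by (auto simp: is_cone_def)
  have "(\<lambda>k. inverse (real (Suc k)) *\<^sub>R x) \<longlonglongrightarrow> 0 *\<^sub>R x"
    by (intro tendsto_scaleR LIMSEQ_inverse_real_of_nat tendsto_const)
  moreover have "inverse (real (Suc k)) *\<^sub>R x \<in> K" for k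
    using assms x by (simp add: is_cone_def)
  ultimately show ?thesis
    using assms closed_sequentially[of K "\<lambda>k. inverse (real (Suc k)) *\<^sub>R x"] by auto
qed

lemma asymptotic_cone_closed_cone:
  fixes K :: "'a::real_normed_vector set"
  assumes "closed K" "is_cone K"
  shows "asymptotic_cone K = K"
proof (intro equalityI subsetI)
  fix v assume "v \<in> asymptotic_cone K"
  then obtain t :: "nat \<Rightarrow> real" and x where
    t: "filterlim t at_top sequentially" and x: "\<And>k. x k \<in> K" and lim: "(\<lambda>k. x k /\<^sub>R t k) \<longlonglongrightarrow> v"
    by (auto simp: asymptotic_cone_def)
  have "eventually (\<lambda>k. t k > 0) sequentially"
    using t by (simp add: filterlim_at_top_dense)
  then have "eventually (\<lambda>k. x k /\<^sub>R t k \<in> K) sequentially"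
    by eventually_elim (use assms x in \<open>simp add: is_cone_def\<close>)
  from Lim_in_closed_set[OF assms(1) this _ lim] show "v \<in> K" by simp
next
  fix v assume v: "v \<in> K"
  have "filterlim (\<lambda>k. real (Suc k)) at_top sequentially"
    by (rule filterlim_compose[OF filterlim_real_sequentially filterlim_Suc])
  moreover have "\<forall>k. real (Suc k) *\<^sub>R v \<in> K"
    using assms v by (simp add: is_cone_def del: of_nat_Suc)
  moreover have "(\<lambda>k. (real (Suc k) *\<^sub>R v) /\<^sub>R real (Suc k)) \<longlonglongrightarrow> v"
    by (simp del: of_nat_Suc)
  ultimately show "v \<in> asymptotic_cone K"
    unfolding asymptotic_cone_def
    by (intro CollectI exI[of _ "\<lambda>k. real (Suc k)"] exI[of _ "\<lambda>k. real (Suc k) *\<^sub>R v"] conjI)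
qed

text \<open>
  Replacing the test point \<open>y\<close> by \<open>y / t\<close>, which stays in the cone, turns the inequality at \<open>t x\<close>
  into the one at \<open>x\<close>, multiplied by the positive number \<open>s t\<close>.
\<close>

lemma SOL_cone_scale:
  assumes "is_cone K" "x \<in> SOL K F" "t > 0" "s > 0" "G (t *\<^sub>R x) = s *\<^sub>R F x"
  shows "t *\<^sub>R x \<in> SOL K G"
proof -
  have "x \<in> K" using assms(2) by (simp add: SOL_def)
  moreover have "G (t *\<^sub>R x) \<bullet> (y - t *\<^sub>R x) \<ge> 0" if "y \<in> K" for y
  proof -
    have "y /\<^sub>R t \<in> K" using assms(1,3) that by (simp add: is_cone_def)
    then have "F x \<bullet> (y /\<^sub>R t - x) \<ge> 0" using assms(2) by (simp add: SOL_def)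
    then have "(s * t) * (F x \<bullet> (y /\<^sub>R t - x)) \<ge> 0" using assms(3,4) by simp
    moreover have "y - t *\<^sub>R x = t *\<^sub>R (y /\<^sub>R t - x)"
      using assms(3) by (simp add: scaleR_diff_right)
    then have "G (t *\<^sub>R x) \<bullet> (y - t *\<^sub>R x) = (s * t) * (F x \<bullet> (y /\<^sub>R t - x))"
      by (simp only: assms(5) inner_scaleR_left inner_scaleR_right ac_simps)
    ultimately show ?thesis by simp
  qed
  ultimately show ?thesis
    using assms(1,3) by (simp add: SOL_def is_cone_def)
qed


section \<open>Upper semicontinuity forces the leading part to have only the zero solution\<close>

lemma usc_at_pm_topologyD:
  assumes "usc_at (pm_topology e) Y \<Psi> P" "openin Y V" "\<Psi> P \<subseteq> V"
  obtains r where "r > 0" "\<And>R. R \<in> pm_space e \<Longrightarrow> pm_dist P R < r \<Longrightarrow> \<Psi> R \<subseteq> V"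
proof -
  interpret Metric_space "pm_space e" pm_dist by (rule Metric_space_pm_dist)
  obtain U where "openin (pm_topology e) U" "P \<in> U" and U: "\<forall>R\<in>U. \<Psi> R \<subseteq> V"
    using assms by (auto simp: usc_at_def)
  then obtain r where "r > 0" "mball P r \<subseteq> U" and "P \<in> pm_space e"
    unfolding pm_topology_def openin_mtopology by blast
  with U that show ?thesis
    by (meson in_mball subsetD)
qed

theorem theorem3p2:
  fixes K :: "(real ^ 'n::finite) set" and P :: "'n polymap" and d :: nat
  assumes "K \<noteq> {}" and "closed K" and "convex K"
    and "pm_degree P = d" and "d > 0"
    and "is_cone K"
    and "\<exists>Q\<in>pm_space (d - 1).
           SOL K (pm_eval (P + Q)) \<noteq> {} \<and> bounded (SOL K (pm_eval (P + Q))) \<and>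
           usc_at (pm_topology d) euclidean (\<lambda>R. SOL K (pm_eval R)) (P + Q)"
  shows "R0_pair K P"
proof -
  obtain Q where Q: "Q \<in> pm_space (d - 1)" and bdd: "bounded (SOL K (pm_eval (P + Q)))"
    and usc: "usc_at (pm_topology d) euclidean (\<lambda>R. SOL K (pm_eval R)) (P + Q)"
    using assms(7) by blast
  let ?S = "P + Q" and ?F = "pm_eval (pm_infinity P)"
  have S: "?S \<in> pm_space d"
    using usc by (simp add: usc_at_def topspace_pm_topology)
  have degQ: "poly_degree (Q $ l) < d" for l
  proof -
    have "poly_degree (Q $ l) \<le> d - 1" using Q by (simp add: pm_space_def)
    with \<open>d > 0\<close> show ?thesis by linarith
  qed
  have F: "?F x $ l = poly_eval (hom_component d (?S $ l)) x" for x l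
    using assms(4) degQ by (simp add: pm_eval_def pm_infinity_def hom_component_add_lower_degree)
  have "?F 0 = 0"
    using \<open>d > 0\<close> by (simp add: vec_eq_iff F poly_eval_hom_component_zero)
  then have zero: "0 \<in> SOL K ?F"
    using zero_in_closed_cone[OF assms(2,6)] by (simp add: SOL_def)
  have "x = 0" if x: "x \<in> SOL K ?F" for x
  proof (rule ccontr)
    assume "x \<noteq> 0"
    then obtain i where i: "x $ i \<noteq> 0" by (auto simp: vec_eq_iff)
    obtain B where B: "SOL K (pm_eval ?S) \<subseteq> ball 0 B"
      using bdd bounded_subset_ballD by blast
    obtain r where r: "r > 0"
      and near: "\<And>R. R \<in> pm_space d \<Longrightarrow> pm_dist ?S R < r \<Longrightarrow> SOL K (pm_eval R) \<subseteq> ball 0 B"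
      using usc_at_pm_topologyD[OF usc _ B] by auto
    \<comment> \<open>chosen so that the perturbed map takes the value \<open>t ^ d *\<^sub>R ?F x\<close> at \<open>t *\<^sub>R x\<close>\<close>
    define a where "a t = (?F x - pm_eval ?S (t *\<^sub>R x) /\<^sub>R t ^ d) /\<^sub>R (x $ i) ^ d" for t
    define R where "R t = ?S + power_perturbation i d (a t)" for t
    have "((\<lambda>t. pm_eval ?S (t *\<^sub>R x) /\<^sub>R t ^ d) \<longlongrightarrow> ?F x) at_top"
    proof (rule vec_tendstoI)
      fix l
      have "poly_degree (?S $ l) \<le> d" using S by (simp add: pm_space_def)
      from tendsto_poly_eval_ray[OF this, of x]
      show "((\<lambda>t. (pm_eval ?S (t *\<^sub>R x) /\<^sub>R t ^ d) $ l) \<longlongrightarrow> ?F x $ l) at_top"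
        unfolding F by (simp add: pm_eval_def divide_inverse mult.commute)
    qed
    then have "(a \<longlongrightarrow> (?F x - ?F x) /\<^sub>R (x $ i) ^ d) at_top"
      unfolding a_def by (intro tendsto_intros)
    then have "eventually (\<lambda>t. norm (a t) < r) at_top"
      using r by (simp add: tendsto_iff)
    moreover have "eventually (\<lambda>t. t > 0 \<and> t > B / norm x) at_top"
      by (intro eventually_conj eventually_gt_at_top)
    ultimately have "eventually (\<lambda>t. norm (a t) < r \<and> t > 0 \<and> t > B / norm x) at_top"
      by (rule eventually_conj)
    then obtain t where small: "norm (a t) < r" and t: "t > 0" "t > B / norm x"
      by (auto dest: eventually_happens)
    have "pm_dist ?S (R t) = pm_dist (R t) ?S"
      by (rule Metric_space.commute[OF Metric_space_pm_dist])
    also have "\<dots> = norm (a t)"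
      by (simp add: pm_dist_def R_def pm_norm_power_perturbation)
    finally have "SOL K (pm_eval (R t)) \<subseteq> ball 0 B"
      using small unfolding R_def
      by (intro near pm_space_add S power_perturbation_in_pm_space) auto
    moreover have "t *\<^sub>R x \<in> SOL K (pm_eval (R t))"
    proof (rule SOL_cone_scale[OF assms(6) x])
      show "pm_eval (R t) (t *\<^sub>R x) = t ^ d *\<^sub>R ?F x"
        using t(1) i
        unfolding R_def pm_eval_add[of ?S] pm_eval_power_perturbation a_def
        by (simp add: vec_eq_iff field_simps)
    qed (use t in auto)
    ultimately have "t * norm x < B" using t(1) by auto
    with t(2) \<open>x \<noteq> 0\<close> show False by (simp add: field_simps)
  qed
  with zero show ?thesis
    by (auto simp: R0_pair_def asymptotic_cone_closed_cone[OF assms(2,6)])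
qed

end
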